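(* Let $n$ be a positive integer and let $[\alpha_1|\beta_1],[\alpha_2|\beta_2]\in S\text{-}Block(n)$ with $[\alpha_1|\beta_1]\succeq[\alpha_2|\beta_2]$. If $[\alpha_1|\beta_1]$ is balanced, then $[\alpha_2|\beta_2]$ is balanced. If $[\alpha_2|\beta_2]$ is unbalanced, then $[\alpha_1|\beta_1]$ is unbalanced.
   Context: $Dis(n)$ is the set of partitions $\gamma=(g_1,\dots,g_r)$ of $n$ into distinct positive parts $g_1>\dots>g_r>0$, with $\mathrm{len}(\gamma)=r$. For $\gamma=(g_1,\dots,g_r)$ and $\delta=(d_1,\dots,d_s)$ in $Dis(n)$, $\delta\succeq\gamma$ ($\delta$ majorizes $\gamma$) means $\sum_{i=1}^k d_i\ge\sum_{i=1}^k g_i$ for all $k\le\min\{r,s\}$. An $S$-block is an ordered pair $[\alpha|\beta]$ with $\alpha,\beta\in Dis(n)$, $\beta\succeq\alpha$, and $\mathrm{len}(\alpha)\in\{\mathrm{len}(\beta),\mathrm{len}(\beta)+1\}$. $S\text{-}Block(n)$ is the poset of all such $S$-blocks, ordered by $[\alpha_1|\beta_1]\succeq[\alpha_2|\beta_2]$ iff $\alpha_1\succeq\alpha_2$ and $\beta_1\preceq\beta_2$. Graphs are finite and simple, without isolated vertices. For a degree sequence $\pi=(d_1\ge\dots\ge d_r)$, $\alpha(\pi)$ has $i$-th part $d_i-i+1$ for those $i$ with $d_i\ge i$, and $\beta(\pi)$ has $j$-th part $|\{i:d_i\ge j\}|-j$ for those $j$ for which this is positive (rows of the Ferrers diagram on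 and right of the main diagonal; columns below the main diagonal). A split graph is a graph with a partition $V(G)=K\cup S$ with $K$ a clique and $S$ a stable set ($KS$-partition; either part may be empty). It is balanced if it has a $KS$-partition in which $|K|$ is the size of a largest clique and $|S|$ is the size of a largest stable set simultaneously, and unbalanced otherwise. An $S$-block $[\alpha|\beta]$ is called balanced (resp. unbalanced) if there is a balanced (resp. unbalanced) split graph with degree sequence $\pi$ such that $\alpha=\alpha(\pi)$ and $\beta=\beta(\pi)$. It is known that a sequence $\pi$ is the degree sequence of a split graph if and only if $[\alpha(\pi)|\beta(\pi)]$ is an $S$-block. *)

theory Defs
  imports Main "HOL-Library.Multiset"
begin

section \<open>Partitions into distinct parts and S-blocks\<close>

text \<open>A partition is the list of its parts in decreasing order.\<close>

definition Dis :: "nat \<Rightarrow> nat list set" where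
  "Dis n = {\<gamma>. sorted_wrt (>) \<gamma> \<and> (\<forall>g \<in> set \<gamma>. g > 0) \<and> sum_list \<gamma> = n}"

definition majorizes :: "nat list \<Rightarrow> nat list \<Rightarrow> bool" where
  "majorizes \<delta> \<gamma> \<longleftrightarrow>
     (\<forall>k \<le> min (length \<gamma>) (length \<delta>). sum_list (take k \<delta>) \<ge> sum_list (take k \<gamma>))"

definition S_Block :: "nat \<Rightarrow> (nat list \<times> nat list) set" where
  "S_Block n = {(\<alpha>, \<beta>). \<alpha> \<in> Dis n \<and> \<beta> \<in> Dis n \<and> majorizes \<beta> \<alpha> \<and>
     length \<alpha> \<in> {length \<beta>, length \<beta> + 1}}"

definition block_ge :: "nat list \<times> nat list \<Rightarrow> nat list \<times> nat list \<Rightarrow> bool" where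
  "block_ge B1 B2 \<longleftrightarrow> majorizes (fst B1) (fst B2) \<and> majorizes (snd B2) (snd B1)"

section \<open>Finite simple graphs without isolated vertices\<close>

definition simple_graph :: "'v set \<Rightarrow> 'v set set \<Rightarrow> bool" where
  "simple_graph V E \<longleftrightarrow> finite V \<and> (\<forall>e \<in> E. e \<subseteq> V \<and> card e = 2) \<and> (\<forall>v \<in> V. \<exists>e \<in> E. v \<in> e)"

definition degree :: "'v set set \<Rightarrow> 'v \<Rightarrow> nat" where
  "degree E v = card {e \<in> E. v \<in> e}"

definition degree_sequence :: "'v set \<Rightarrow> 'v set set \<Rightarrow> nat list" where
  "degree_sequence V E = rev (sorted_list_of_multiset (image_mset (degree E) (mset_set V)))"

definition clique :: "'v set \<Rightarrow> 'v set set \<Rightarrow> 'v set \<Rightarrow> bool" where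
  "clique V E K \<longleftrightarrow> K \<subseteq> V \<and> (\<forall>u \<in> K. \<forall>v \<in> K. u \<noteq> v \<longrightarrow> {u, v} \<in> E)"

definition stable_set :: "'v set \<Rightarrow> 'v set set \<Rightarrow> 'v set \<Rightarrow> bool" where
  "stable_set V E S \<longleftrightarrow> S \<subseteq> V \<and> (\<forall>u \<in> S. \<forall>v \<in> S. {u, v} \<notin> E)"

definition clique_number :: "'v set \<Rightarrow> 'v set set \<Rightarrow> nat" where
  "clique_number V E = Max (card ` {K. clique V E K})"

definition stability_number :: "'v set \<Rightarrow> 'v set set \<Rightarrow> nat" where
  "stability_number V E = Max (card ` {S. stable_set V E S})"

section \<open>Split graphs\<close>

definition KS_partition :: "'v set \<Rightarrow> 'v set set \<Rightarrow> 'v set \<Rightarrow> 'v set \<Rightarrow> bool" where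
  "KS_partition V E K S \<longleftrightarrow> V = K \<union> S \<and> K \<inter> S = {} \<and> clique V E K \<and> stable_set V E S"

definition split_graph :: "'v set \<Rightarrow> 'v set set \<Rightarrow> bool" where
  "split_graph V E \<longleftrightarrow> simple_graph V E \<and> (\<exists>K S. KS_partition V E K S)"

definition balanced_split_graph :: "'v set \<Rightarrow> 'v set set \<Rightarrow> bool" where
  "balanced_split_graph V E \<longleftrightarrow> split_graph V E \<and>
     (\<exists>K S. KS_partition V E K S \<and> card K = clique_number V E \<and> card S = stability_number V E)"

definition unbalanced_split_graph :: "'v set \<Rightarrow> 'v set set \<Rightarrow> bool" where
  "unbalanced_split_graph V E \<longleftrightarrow> split_graph V E \<and> \<not> balanced_split_graph V E"

section \<open>The pair of partitions attached to a degree sequence\<close>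

text \<open>Indices \<open>i\<close>, \<open>j\<close> start at 1, so the \<open>i\<close>-th part of \<open>\<pi>\<close> is \<open>\<pi> ! (i - 1)\<close>.
  In \<open>beta_part\<close> it suffices to let \<open>j\<close> range up to \<open>length \<pi>\<close>, since
  \<open>conj_part \<pi> j \<le> length \<pi>\<close>.\<close>

definition alpha_part :: "nat list \<Rightarrow> nat list" where
  "alpha_part \<pi> = [\<pi> ! (i - 1) + 1 - i. i \<leftarrow> [1..<length \<pi> + 1], \<pi> ! (i - 1) \<ge> i]"

definition conj_part :: "nat list \<Rightarrow> nat \<Rightarrow> nat" where
  "conj_part \<pi> j = card {i \<in> {1..length \<pi>}. \<pi> ! (i - 1) \<ge> j}"

definition beta_part :: "nat list \<Rightarrow> nat list" where
  "beta_part \<pi> = [conj_part \<pi> j - j. j \<leftarrow> [1..<length \<pi> + 1], conj_part \<pi> j > j]"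

section \<open>Balanced and unbalanced blocks\<close>

text \<open>Every finite graph is isomorphic to one whose vertices are natural numbers, so it loses
  nothing to quantify over graphs with vertices in \<^typ>\<open>nat\<close>.\<close>

definition balanced_block :: "nat list \<times> nat list \<Rightarrow> bool" where
  "balanced_block B \<longleftrightarrow> (\<exists>(V :: nat set) E. balanced_split_graph V E \<and>
     B = (alpha_part (degree_sequence V E), beta_part (degree_sequence V E)))"

definition unbalanced_block :: "nat list \<times> nat list \<Rightarrow> bool" where
  "unbalanced_block B \<longleftrightarrow> (\<exists>(V :: nat set) E. unbalanced_split_graph V E \<and>
     B = (alpha_part (degree_sequence V E), beta_part (degree_sequence V E)))"

end

theory Submission imports Defs begin

text \<open>
  Whether an S-block is balanced depends only on the lengths of its two partitions:
  \<open>[\<alpha>|\<beta>]\<close> is balanced if \<open>\<alpha>\<close> has one part more than \<open>\<beta>\<close>, and unbalanced if the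
  lengths agree (lemmas \<open>balanced_block_iff\<close> and \<open>unbalanced_block_iff\<close>).  If one partition
  of \<open>n\<close> majorizes another, it has at most as many parts (\<open>majorizes_length_le\<close>), because
  its partial sum over the length of the other is already \<open>n\<close>.  So going down in the order
  on S-blocks, \<open>\<alpha>\<close> can only get longer and \<open>\<beta>\<close> only shorter.  The difference of the lengths
  is always 0 or 1, hence once it is 1 it stays 1, and once it is 0 it was 0 all along.

  The criterion by lengths has two ingredients.  Let \<open>f j\<close> be the number of vertices of degree
  at least \<open>j\<close>.  The parts of \<open>\<alpha>\<close> correspond to the \<open>i \<ge> 1\<close> with \<open>f i \<ge> i\<close> and those of \<open>\<beta>\<close> to
  the \<open>i\<close> with \<open>f i > i\<close>, so the lengths differ exactly when the antitone function \<open>f\<close>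
  has a fixed point \<open>i \<ge> 1\<close>.  In a split graph, such a fixed point means that
  the vertices of degree at least \<open>i\<close> form a clique of \<open>i\<close> vertices, each with a neighbour in
  the stable complement, while no vertex of the complement is adjacent to the whole clique.
  This is precisely balance (\<open>balanced_iff_length\<close>).

  The second ingredient is that every S-block arises from a split graph
  (\<open>S_block_realizable\<close>).  The edges between clique and stable set are a bipartite graph with
  prescribed degrees on both sides, and majorization is the condition of Gale and Ryser.
  Their theorem is proved by starting from nested neighbourhoods and moving single neighbours
  from one clique vertex to another, which leaves the degrees on the stable side unchanged
  (\<open>exists_sets_of_sizes\<close>).
\<close>

section \<open>Degree counts and the lengths of the two partitions\<close>

definition degree_count :: "'v set \<Rightarrow> 'v set set \<Rightarrow> nat \<Rightarrow> nat" where
  "degree_count V E j = card {v \<in> V. degree E v \<ge> j}"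

lemma degree_count_antimono:
  assumes "finite V" "i \<le> j"
  shows "degree_count V E j \<le> degree_count V E i"
  unfolding degree_count_def using assms by (intro card_mono) auto

lemma concat_map_if: "concat (map (\<lambda>i. if P i then [f i] else []) xs) = map f (filter P xs)"
  by (induction xs) auto

lemma alpha_part_eq:
  "alpha_part \<pi> = map (\<lambda>i. \<pi> ! (i - 1) + 1 - i) (filter (\<lambda>i. \<pi> ! (i - 1) \<ge> i) [1..<length \<pi> + 1])"
  unfolding alpha_part_def by (rule concat_map_if)

lemma beta_part_eq:
  "beta_part \<pi> = map (\<lambda>j. conj_part \<pi> j - j) (filter (\<lambda>j. conj_part \<pi> j > j) [1..<length \<pi> + 1])"
  unfolding beta_part_def by (rule concat_map_if)

lemma length_filter_upt: "length (filter P [1..<N + 1]) = card {i \<in> {1..N}. P i}"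
proof -
  have "length (filter P [1..<N + 1]) = card (set (filter P [1..<N + 1]))"
    by (rule distinct_card[symmetric]) simp
  also have "set (filter P [1..<N + 1]) = {i \<in> {1..N}. P i}" by auto
  finally show ?thesis .
qed

lemma filter_upt_initial:
  assumes "p \<le> N" "\<And>i. 1 \<le> i \<Longrightarrow> i \<le> N \<Longrightarrow> P i \<longleftrightarrow> i \<le> p"
  shows "filter P [1..<N + 1] = [1..<p + 1]"
proof -
  have "[1..<N + 1] = [1..<p + 1] @ [p + 1..<N + 1]"
    using upt_add_eq_append[of 1 "p + 1" "N - p"] assms(1) by simp
  moreover have "filter P [1..<p + 1] = [1..<p + 1]"
    using assms by (intro filter_True) auto
  moreover have "filter P [p + 1..<N + 1] = []"
    using assms by (intro filter_False) auto
  ultimately show ?thesis by (metis append_Nil2 filter_append)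
qed

text \<open>Conjugation of Ferrers diagrams: the indices of the parts of size at least \<open>j\<close> form an
  initial segment, and \<open>conj_part\<close> is its length.  This lets the rows counted by \<open>\<alpha>\<close> be
  compared with the columns counted by \<open>\<beta>\<close>.\<close>

lemma decreasing_nth_ge_iff:
  assumes "sorted_wrt (\<ge>) \<pi>" "1 \<le> i" "i \<le> length \<pi>"
  shows "\<pi> ! (i - 1) \<ge> j \<longleftrightarrow> i \<le> conj_part \<pi> j"
proof -
  let ?T = "{i \<in> {1..length \<pi>}. \<pi> ! (i - 1) \<ge> j}"
  have mono: "\<pi> ! (q - 1) \<le> \<pi> ! (p - 1)" if "1 \<le> p" "p \<le> q" "q \<le> length \<pi>" for p q
    using assms(1) that sorted_wrt_nth_less[of "(\<ge>)" \<pi> "p - 1" "q - 1"]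
    by (cases "p = q") auto
  show ?thesis
  proof
    assume h: "\<pi> ! (i - 1) \<ge> j"
    have "{1..i} \<subseteq> ?T" using mono[of _ i] h assms by (auto intro: order_trans)
    then have "card {1..i} \<le> card ?T" by (intro card_mono) auto
    then show "i \<le> conj_part \<pi> j" by (simp add: conj_part_def)
  next
    assume h: "i \<le> conj_part \<pi> j"
    show "\<pi> ! (i - 1) \<ge> j"
    proof (rule ccontr)
      assume n: "\<not> \<pi> ! (i - 1) \<ge> j"
      have "?T \<subseteq> {1..<i}"
      proof
        fix p assume "p \<in> ?T"
        then show "p \<in> {1..<i}" using mono[of i p] n assms by force
      qed
      then have "card ?T \<le> card {1..<i}" by (intro card_mono) auto
      then show False using h assms by (simp add: conj_part_def)
    qed
  qed
qed

lemma sorted_degree_sequence: "sorted_wrt (\<ge>) (degree_sequence V E)"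
  unfolding degree_sequence_def by (simp add: sorted_wrt_rev)

lemma length_degree_sequence: "finite V \<Longrightarrow> length (degree_sequence V E) = card V"
  unfolding degree_sequence_def by (metis length_rev size_image_mset size_mset size_mset_set mset_sorted_list_of_multiset)

lemma conj_part_degree_sequence:
  assumes "finite V"
  shows "conj_part (degree_sequence V E) j = degree_count V E j"
proof -
  let ?p = "degree_sequence V E"
  have "conj_part ?p j = card {i. i < length ?p \<and> ?p ! i \<ge> j}"
    unfolding conj_part_def
    by (rule bij_betw_same_card[of "\<lambda>i. i - 1"], rule bij_betw_byWitness[where f' = Suc])
      (auto simp: Suc_le_eq)
  also have "\<dots> = length (filter (\<lambda>d. j \<le> d) ?p)" by (simp add: length_filter_conv_card)
  also have "\<dots> = size (filter_mset (\<lambda>d. j \<le> d) (mset ?p))" by (metis mset_filter size_mset)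
  also have "mset ?p = image_mset (degree E) (mset_set V)"
    unfolding degree_sequence_def by simp
  also have "size (filter_mset (\<lambda>d. j \<le> d) \<dots>) = degree_count V E j"
    using assms by (simp add: filter_mset_image_mset degree_count_def)
  finally show ?thesis .
qed

text \<open>Both lengths count indices by comparing \<open>degree_count V E i\<close> with \<open>i\<close>, once weakly
  and once strictly; they differ by the number of ties.\<close>

lemma length_alpha_part:
  assumes "finite V"
  shows "length (alpha_part (degree_sequence V E))
    = length (beta_part (degree_sequence V E)) + card {i \<in> {1..card V}. degree_count V E i = i}"
proof -
  let ?p = "degree_sequence V E" and ?f = "degree_count V E"
  have N: "length ?p = card V" using assms by (rule length_degree_sequence)
  have "length (alpha_part ?p) = card {i \<in> {1..card V}. ?p ! (i - 1) \<ge> i}"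
    unfolding alpha_part_eq length_map length_filter_upt N ..
  also have "{i \<in> {1..card V}. ?p ! (i - 1) \<ge> i} = {i \<in> {1..card V}. ?f i \<ge> i}"
    using decreasing_nth_ge_iff[OF sorted_degree_sequence, of _ V E]
    by (intro Collect_cong) (auto simp del: One_nat_def simp: N conj_part_degree_sequence[OF assms])
  also have "\<dots> = {i \<in> {1..card V}. ?f i > i} \<union> {i \<in> {1..card V}. ?f i = i}" by auto
  also have "card \<dots> = card {i \<in> {1..card V}. ?f i > i} + card {i \<in> {1..card V}. ?f i = i}"
    by (rule card_Un_disjoint) auto
  also have "card {i \<in> {1..card V}. ?f i > i} = length (beta_part ?p)"
    unfolding beta_part_eq length_map length_filter_upt N conj_part_degree_sequence[OF assms] ..
  finally show ?thesis .
qed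

text \<open>An antitone function has at most one fixed point.\<close>

lemma length_alpha_part_fixpoint:
  assumes "finite V"
  shows "length (alpha_part (degree_sequence V E)) = length (beta_part (degree_sequence V E)) +
    (if \<exists>i\<ge>1. degree_count V E i = i then 1 else 0)"
proof -
  let ?F = "{i \<in> {1..card V}. degree_count V E i = i}"
  have le: "degree_count V E i \<le> card V" for i
    unfolding degree_count_def using assms by (intro card_mono) auto
  have uniq: "i = j" if "degree_count V E i = i" "degree_count V E j = j" for i j
    using degree_count_antimono[OF assms, of i j E] degree_count_antimono[OF assms, of j i E] that
    by (cases i j rule: linorder_cases) auto
  have "card ?F = (if \<exists>i\<ge>1. degree_count V E i = i then 1 else 0)"
  proof (cases "\<exists>i\<ge>1. degree_count V E i = i")
    case True
    then obtain i where i: "i \<ge> 1" "degree_count V E i = i" by blast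
    then have "?F = {i}" using uniq le[of i] by auto
    then show ?thesis using True by simp
  next
    case False
    then have "?F = {}" by auto
    then have "card ?F = 0" by (simp only: card.empty)
    then show ?thesis unfolding if_not_P[OF False] .
  qed
  then show ?thesis using length_alpha_part[OF assms] by simp
qed

section \<open>Recognising balance from the degrees\<close>

lemma degree_eq_card_neighbours:
  assumes "simple_graph V E"
  shows "degree E v = card {u. {u, v} \<in> E}"
proof -
  have "bij_betw (\<lambda>u. {u, v}) {u. {u, v} \<in> E} {e \<in> E. v \<in> e}"
  proof (rule bij_betw_imageI)
    show "inj_on (\<lambda>u. {u, v}) {u. {u, v} \<in> E}" by (auto simp: inj_on_def doubleton_eq_iff)
    show "(\<lambda>u. {u, v}) ` {u. {u, v} \<in> E} = {e \<in> E. v \<in> e}"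
    proof
      show "{e \<in> E. v \<in> e} \<subseteq> (\<lambda>u. {u, v}) ` {u. {u, v} \<in> E}"
      proof
        fix e assume e: "e \<in> {e \<in> E. v \<in> e}"
        then have "card e = 2" using assms by (auto simp: simple_graph_def)
        then obtain x y where "e = {x, y}" by (auto simp: card_2_iff)
        then obtain u where "e = {u, v}" using e by (auto simp: insert_commute)
        then show "e \<in> (\<lambda>u. {u, v}) ` {u. {u, v} \<in> E}" using e by auto
      qed
    qed auto
  qed
  then show ?thesis unfolding degree_def by (simp add: bij_betw_same_card)
qed

lemma edge_vertices:
  assumes "simple_graph V E" "{u, v} \<in> E"
  shows "u \<in> V" "v \<in> V" "u \<noteq> v"
  using assms by (force simp: simple_graph_def)+

lemma finite_neighbours:
  assumes "simple_graph V E"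
  shows "finite {u. {u, v} \<in> E}"
  using assms edge_vertices(1)[OF assms] by (auto simp: simple_graph_def intro: finite_subset[of _ V])

lemma clique_degree_ge:
  assumes "simple_graph V E" "clique V E Q" "v \<in> Q"
  shows "card Q - 1 \<le> degree E v"
proof -
  have "Q - {v} \<subseteq> {u. {u, v} \<in> E}" using assms by (auto simp: clique_def)
  then have "card (Q - {v}) \<le> degree E v"
    unfolding degree_eq_card_neighbours[OF assms(1)] using finite_neighbours[OF assms(1)]
    by (intro card_mono)
  then show ?thesis using assms(3) by simp
qed

lemma neighbours_stable_subset:
  assumes "simple_graph V E" "KS_partition V E K S" "v \<in> S"
  shows "{u. {u, v} \<in> E} \<subseteq> K"
proof
  fix u assume "u \<in> {u. {u, v} \<in> E}"
  then have uv: "{u, v} \<in> E" by simp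
  show "u \<in> K"
    using edge_vertices(1)[OF assms(1) uv] uv assms(2,3)
    unfolding KS_partition_def stable_set_def by blast
qed

lemma KS_partition_finite:
  assumes "simple_graph V E" "KS_partition V E K S"
  shows "finite V" "finite K" "finite S"
  using assms by (auto simp: simple_graph_def KS_partition_def)

lemma stable_degree_le:
  assumes "simple_graph V E" "KS_partition V E K S" "v \<in> S"
  shows "degree E v \<le> card K"
  unfolding degree_eq_card_neighbours[OF assms(1)]
  using neighbours_stable_subset[OF assms] KS_partition_finite[OF assms(1,2)] by (intro card_mono)

lemma stable_degree_eq_imp_adjacent:
  assumes "simple_graph V E" "KS_partition V E K S" "v \<in> S" "card K \<le> degree E v" "u \<in> K"
  shows "{u, v} \<in> E"
proof -
  have "{u. {u, v} \<in> E} = K"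
    using neighbours_stable_subset[OF assms(1-3)] KS_partition_finite[OF assms(1,2)] assms(4)
    unfolding degree_eq_card_neighbours[OF assms(1)] by (intro card_seteq)
  then show ?thesis using assms(5) by blast
qed

text \<open>A neighbour outside the clique comes on top of the \<open>card K - 1\<close> neighbours inside.\<close>

lemma clique_degree_ge_card:
  assumes "simple_graph V E" "KS_partition V E K S" "u \<in> K" "w \<in> S" "{w, u} \<in> E"
  shows "card K \<le> degree E u"
proof -
  have "insert w (K - {u}) \<subseteq> {x. {x, u} \<in> E}"
    using assms by (auto simp: KS_partition_def clique_def)
  then have "card (insert w (K - {u})) \<le> degree E u"
    unfolding degree_eq_card_neighbours[OF assms(1)] using finite_neighbours[OF assms(1)]
    by (intro card_mono)
  moreover have "card (insert w (K - {u})) = Suc (card (K - {u}))"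
    using assms KS_partition_finite[OF assms(1,2)]
    by (intro card_insert_disjoint) (auto simp: KS_partition_def)
  moreover have "Suc (card (K - {u})) = card K"
    using assms(3) KS_partition_finite[OF assms(1,2)] by (intro card_Suc_Diff1)
  ultimately show ?thesis by simp
qed

lemma card_clique_le:
  assumes "finite V" "clique V E Q"
  shows "card Q \<le> clique_number V E"
  unfolding clique_number_def
proof (rule Max_ge)
  have "{K. clique V E K} \<subseteq> Pow V" by (auto simp: clique_def)
  then show "finite (card ` {K. clique V E K})" using assms by (auto intro: finite_subset)
qed (use assms in auto)

lemma card_stable_le:
  assumes "finite V" "stable_set V E Q"
  shows "card Q \<le> stability_number V E"
  unfolding stability_number_def
proof (rule Max_ge)
  have "{K. stable_set V E K} \<subseteq> Pow V" by (auto simp: stable_set_def)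
  then show "finite (card ` {K. stable_set V E K})" using assms by (auto intro: finite_subset)
qed (use assms in auto)

lemma clique_number_eqI:
  assumes "finite V" "clique V E K" "\<And>Q. clique V E Q \<Longrightarrow> card Q \<le> card K"
  shows "clique_number V E = card K"
  unfolding clique_number_def
proof (rule Max_eqI)
  have "{K. clique V E K} \<subseteq> Pow V" by (auto simp: clique_def)
  then show "finite (card ` {K. clique V E K})" using assms by (auto intro: finite_subset)
qed (use assms in auto)

lemma stability_number_eqI:
  assumes "finite V" "stable_set V E S" "\<And>Q. stable_set V E Q \<Longrightarrow> card Q \<le> card S"
  shows "stability_number V E = card S"
  unfolding stability_number_def
proof (rule Max_eqI)
  have "{K. stable_set V E K} \<subseteq> Pow V" by (auto simp: stable_set_def)
  then show "finite (card ` {K. stable_set V E K})" using assms by (auto intro: finite_subset)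
qed (use assms in auto)

text \<open>The fixed point is \<open>card K\<close>.  A clique vertex of degree less than \<open>card K\<close> has no
  neighbour in \<open>S\<close> and could be added to \<open>S\<close>; a vertex of \<open>S\<close> of degree at least \<open>card K\<close> is
  adjacent to all of \<open>K\<close> and could be added to \<open>K\<close>.  Both contradict maximality, so \<open>K\<close>
  consists exactly of the vertices of degree at least \<open>card K\<close>.  The empty graph is balanced
  with \<open>card K = 0\<close>, which is why it is excluded.\<close>

lemma balanced_imp_fixpoint:
  assumes "balanced_split_graph V E" "V \<noteq> {}"
  shows "\<exists>i\<ge>1. degree_count V E i = i"
proof -
  obtain K S where G: "simple_graph V E" and KS: "KS_partition V E K S"
    and K: "card K = clique_number V E" and S: "card S = stability_number V E"
    using assms by (auto simp: balanced_split_graph_def split_graph_def)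
  note fin = KS_partition_finite[OF G KS]
  have V: "V = K \<union> S" and disj: "K \<inter> S = {}" and cl: "clique V E K" and st: "stable_set V E S"
    using KS by (auto simp: KS_partition_def)
  have loop: "{x} \<notin> E" for x using edge_vertices(3)[OF G, of x x] by auto
  have high: "card K \<le> degree E u" if u: "u \<in> K" for u
  proof (rule ccontr)
    assume "\<not> card K \<le> degree E u"
    then have "{w, u} \<notin> E" if "w \<in> S" for w
      using clique_degree_ge_card[OF G KS u that] by blast
    then have "stable_set V E (insert u S)"
      using st u V loop by (auto simp: stable_set_def insert_commute)
    from card_stable_le[OF fin(1) this] S show False
      using u disj fin by (auto simp: card_insert_if split: if_splits)
  qed
  have low: "degree E v < card K" if v: "v \<in> S" for v
  proof (rule ccontr)
    assume "\<not> degree E v < card K"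
    then have "{u, v} \<in> E" if "u \<in> K" for u
      using stable_degree_eq_imp_adjacent[OF G KS v _ that] by simp
    then have "clique V E (insert v K)"
      using cl v V by (auto simp: clique_def insert_commute)
    from card_clique_le[OF fin(1) this] K show False
      using v disj fin by (auto simp: card_insert_if split: if_splits)
  qed
  have "{v \<in> V. degree E v \<ge> card K} = K" using high low V by force
  then have "degree_count V E (card K) = card K" by (simp add: degree_count_def)
  moreover have "card K \<ge> 1"
  proof (cases "S = {}")
    case True
    then show ?thesis using V assms(2) fin by (simp add: Suc_le_eq card_gt_0_iff)
  next
    case False
    then show ?thesis using low by fastforce
  qed
  ultimately show ?thesis by blast
qed

text \<open>Let \<open>T\<close> be the set of the \<open>i\<close> vertices of degree at least \<open>i\<close>.  A clique with more than
  \<open>i\<close> vertices would consist of vertices of \<open>T\<close>, so no clique is larger than \<open>i\<close>.  For any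
  KS-partition this forces \<open>K = T\<close>.  Every vertex of \<open>K\<close> then has a
  neighbour in \<open>S\<close>, so replacing part of \<open>S\<close> by a vertex of \<open>K\<close> never gives a larger stable
  set.\<close>

lemma fixpoint_imp_balanced:
  assumes "split_graph V E" "i \<ge> 1" "degree_count V E i = i"
  shows "balanced_split_graph V E"
proof -
  obtain K S where G: "simple_graph V E" and KS: "KS_partition V E K S"
    using assms by (auto simp: split_graph_def)
  note fin = KS_partition_finite[OF G KS]
  have V: "V = K \<union> S" and disj: "K \<inter> S = {}" and cl: "clique V E K" and st: "stable_set V E S"
    using KS by (auto simp: KS_partition_def)
  define T where "T = {v \<in> V. degree E v \<ge> i}"
  have T: "card T = i" "finite T" using assms(3) fin by (auto simp: T_def degree_count_def)
  have clique_le: "card Q \<le> i" if Q: "clique V E Q" for Q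
  proof (rule ccontr)
    assume "\<not> card Q \<le> i"
    then have "Q \<subseteq> T"
      using clique_degree_ge[OF G Q] Q unfolding T_def clique_def by fastforce
    then have "card Q \<le> card T" using T by (intro card_mono) auto
    then show False using T \<open>\<not> card Q \<le> i\<close> by simp
  qed
  have TK: "T \<subseteq> K"
  proof (rule ccontr)
    assume "\<not> T \<subseteq> K"
    then obtain v where v: "v \<in> S" "v \<in> T" using V by (auto simp: T_def)
    \<comment> \<open>A vertex \<open>v\<close> of \<open>S\<close> in \<open>T\<close> is adjacent to all of \<open>K\<close>, which pushes all of \<open>K\<close> into \<open>T\<close>
      as well and makes \<open>T\<close> too large.\<close>
    have k: "card K = i"
      using stable_degree_le[OF G KS v(1)] clique_le[OF cl] v(2) by (auto simp: T_def)
    have "degree E u \<ge> i" if "u \<in> K" for u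
    proof -
      have "{u, v} \<in> E"
        using stable_degree_eq_imp_adjacent[OF G KS v(1) _ that] v(2) k by (simp add: T_def)
      then show ?thesis
        using clique_degree_ge_card[OF G KS that v(1)] k by (simp add: insert_commute)
    qed
    then have "insert v K \<subseteq> T" using v V by (auto simp: T_def)
    then have "card (insert v K) \<le> card T" using T by (intro card_mono)
    then show False using T k v disj fin by (auto simp: card_insert_if split: if_splits)
  qed
  have TeqK: "T = K" using clique_le[OF cl] T TK fin by (intro card_seteq) auto
  have stable_le: "card Q \<le> card S" if Q: "stable_set V E Q" for Q
  proof (cases "Q \<subseteq> S")
    case True
    then show ?thesis using fin by (intro card_mono)
  next
    case False
    then obtain u where u: "u \<in> Q" "u \<in> K" using Q V by (auto simp: stable_set_def)
    \<comment> \<open>A stable set contains at most one clique vertex \<open>u\<close>, and gains it only by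
      giving up a neighbour \<open>w\<close> of \<open>u\<close> in \<open>S\<close>.\<close>
    have "\<exists>w\<in>S. {w, u} \<in> E"
    proof (rule ccontr)
      assume "\<not> (\<exists>w\<in>S. {w, u} \<in> E)"
      then have "{x. {x, u} \<in> E} \<subseteq> K - {u}" using edge_vertices[OF G] V by blast
      then have "degree E u \<le> card (K - {u})"
        unfolding degree_eq_card_neighbours[OF G] using fin by (intro card_mono) auto
      also have "\<dots> < card K" using u fin by (intro card_Diff1_less)
      finally show False using u TeqK T by (auto simp: T_def)
    qed
    then obtain w where w: "w \<in> S" "{w, u} \<in> E" by blast
    have "x = u" if "x \<in> Q" "x \<in> K" for x
      using that u Q cl unfolding stable_set_def clique_def by blast
    moreover have "Q \<subseteq> V" "w \<notin> Q" using Q w(2) u(1) by (auto simp: stable_set_def)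
    ultimately have "Q \<subseteq> insert u (S - {w})" using V by blast
    then have "card Q \<le> card (insert u (S - {w}))" using fin by (intro card_mono) auto
    also have "\<dots> \<le> Suc (card (S - {w}))" using fin by (simp add: card_insert_if)
    also have "\<dots> = card S" using w fin by (intro card_Suc_Diff1)
    finally show ?thesis .
  qed
  have "card K = clique_number V E"
    using clique_number_eqI[OF fin(1) cl] clique_le TeqK T by simp
  moreover have "card S = stability_number V E"
    using stability_number_eqI[OF fin(1) st] stable_le by simp
  ultimately show ?thesis
    using assms(1) KS by (auto simp: balanced_split_graph_def)
qed

lemma balanced_iff_length:
  assumes "split_graph V E" "V \<noteq> {}"
  shows "balanced_split_graph V E \<longleftrightarrow>
    length (alpha_part (degree_sequence V E)) \<noteq> length (beta_part (degree_sequence V E))"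
proof -
  have "finite V" using assms by (auto simp: split_graph_def simple_graph_def)
  from length_alpha_part_fixpoint[OF this, of E] show ?thesis
    using balanced_imp_fixpoint[OF _ assms(2)] fixpoint_imp_balanced[OF assms(1)]
    by (auto split: if_splits)
qed

section \<open>Set families with prescribed sizes and column counts\<close>

lemma unit_transfer:
  fixes A :: "nat \<Rightarrow> nat set"
  assumes "p < m" "q < m" "x \<in> A p" "x \<notin> A q"
  defines "B \<equiv> A(p := A p - {x}, q := insert x (A q))"
  shows "card {i. i < m \<and> y \<in> B i} = card {i. i < m \<and> y \<in> A i}"
proof (cases "y = x")
  case True
  have pq: "p \<noteq> q" using assms by auto
  let ?C = "{i. i < m \<and> x \<in> A i}"
  have "{i. i < m \<and> x \<in> B i} = insert q (?C - {p})" using assms pq by auto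
  moreover have "card (insert q (?C - {p})) = Suc (card (?C - {p}))"
    using assms by (intro card_insert_disjoint) auto
  moreover have "Suc (card (?C - {p})) = card ?C" using assms by (intro card_Suc_Diff1) auto
  ultimately show ?thesis using True by simp
next
  case False
  then have "y \<in> B i \<longleftrightarrow> y \<in> A i" for i by (auto simp: B_def)
  then show ?thesis by simp
qed

text \<open>The sufficiency half of the Gale--Ryser theorem.  A family of \<open>m\<close> sets is a 0-1 matrix
  with rows \<open>A i\<close>; its column sums are to be kept while its row sums are brought from
  \<open>card (A i)\<close> to \<open>a i\<close>.  As long as the row sums differ, some row \<open>p\<close> is too large and a later
  row \<open>q\<close> too small; \<open>a\<close> being antitone, row \<open>p\<close> is then larger than row \<open>q\<close>, so it has an
  element that can be moved to row \<open>q\<close>.  The transfer may spoil the order of the row sums,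
  but that of the targets \<open>a\<close> is all this comparison uses.  Each transfer lowers some partial sums of
  the row sums and raises none, so the sum of all of them bounds the number of steps.\<close>

lemma exists_sets_of_sizes:
  fixes a :: "nat \<Rightarrow> nat" and A :: "nat \<Rightarrow> nat set"
  assumes anti: "\<And>i j. i \<le> j \<Longrightarrow> j < m \<Longrightarrow> a j \<le> a i"
    and "\<And>i. i < m \<Longrightarrow> finite (A i)"
    and "\<And>k. k \<le> m \<Longrightarrow> (\<Sum>i<k. a i) \<le> (\<Sum>i<k. card (A i))"
    and "(\<Sum>i<m. a i) = (\<Sum>i<m. card (A i))"
  shows "\<exists>B. (\<forall>i<m. finite (B i) \<and> card (B i) = a i) \<and>
    (\<forall>x. card {i. i < m \<and> x \<in> B i} = card {i. i < m \<and> x \<in> A i})"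
  using assms(2-4)
proof (induction "\<Sum>k\<le>m. \<Sum>i<k. card (A i)" arbitrary: A rule: less_induct)
  case less
  show ?case
  proof (cases "\<forall>i<m. card (A i) = a i")
    case True
    then show ?thesis using less.prems by (intro exI[of _ A]) auto
  next
    case False
    \<comment> \<open>With \<open>p\<close> the first wrong row and \<open>q\<close> the first row after it that is too small, the partial
      sums at all \<open>k\<close> in \<open>{p<..q}\<close> exceed those of \<open>a\<close> strictly.  These are the ones that the
      transfer lowers by 1, so domination survives.\<close>
    define p where "p = (LEAST i. i < m \<and> card (A i) \<noteq> a i)"
    have p: "p < m" "card (A p) \<noteq> a p"
      using LeastI_ex[of "\<lambda>i. i < m \<and> card (A i) \<noteq> a i"] False unfolding p_def by auto
    have before: "card (A i) = a i" if "i < p" for i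
      using not_less_Least[of i "\<lambda>i. i < m \<and> card (A i) \<noteq> a i"] that p unfolding p_def by auto
    have pgt: "a p < card (A p)"
      using less.prems(2)[of "Suc p"] p before by simp
    have "\<exists>q. p < q \<and> q < m \<and> card (A q) < a q"
    proof (rule ccontr)
      assume n: "\<not> ?thesis"
      have "(\<Sum>i<m. a i) < (\<Sum>i<m. card (A i))"
      proof (rule sum_strict_mono_ex1)
        show "\<forall>i\<in>{..<m}. a i \<le> card (A i)"
          using n before pgt by (metis lessThan_iff linorder_neqE_nat not_le order.refl less_imp_le)
      qed (use p pgt in auto)
      then show False using less.prems(3) by simp
    qed
    define q where "q = (LEAST q. p < q \<and> q < m \<and> card (A q) < a q)"
    have q: "p < q" "q < m" "card (A q) < a q"
      using LeastI_ex[OF \<open>\<exists>q. p < q \<and> q < m \<and> card (A q) < a q\<close>] unfolding q_def by auto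
    have between: "a i \<le> card (A i)" if "p < i" "i < q" for i
      using not_less_Least[of i "\<lambda>q. p < q \<and> q < m \<and> card (A q) < a q"] that q
      unfolding q_def by auto
    have "card (A q) < card (A p)" using q pgt anti[of p q] by simp
    then have "\<not> A p \<subseteq> A q" using card_mono[of "A q" "A p"] less.prems(1)[of q] q by auto
    then obtain x where x: "x \<in> A p" "x \<notin> A q" by blast
    define B where "B = A(p := A p - {x}, q := insert x (A q))"
    have cp: "Suc (card (B p)) = card (A p)"
      using x q p less.prems(1)[of p] unfolding B_def by (simp add: card_Suc_Diff1 del: card_Diff_insert)
    have cq: "card (B q) = Suc (card (A q))"
      using x q less.prems(1)[of q] unfolding B_def by simp
    have co: "B i = A i" if "i \<noteq> p" "i \<noteq> q" for i using that unfolding B_def by simp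
    have part: "(\<Sum>i<k. card (B i)) + (if p < k \<and> k \<le> q then 1 else 0) = (\<Sum>i<k. card (A i))" for k
    proof (induction k)
      case (Suc k)
      consider "k = p" | "k = q" | "k \<noteq> p" "k \<noteq> q" by blast
      then show ?case using Suc cp cq co[of k] q by cases auto
    qed auto
    have strict: "(\<Sum>i<k. a i) < (\<Sum>i<k. card (A i))" if "p < k" "k \<le> q" for k
    proof (rule sum_strict_mono_ex1)
      show "\<forall>i\<in>{..<k}. a i \<le> card (A i)"
        using before pgt between that by (metis lessThan_iff linorder_neqE_nat order.refl less_imp_le less_le_trans)
    qed (use that pgt in auto)
    have "\<exists>C. (\<forall>i<m. finite (C i) \<and> card (C i) = a i) \<and>
      (\<forall>x. card {i. i < m \<and> x \<in> C i} = card {i. i < m \<and> x \<in> B i})"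
    proof (rule less.hyps)
      show "(\<Sum>k\<le>m. \<Sum>i<k. card (B i)) < (\<Sum>k\<le>m. \<Sum>i<k. card (A i))"
      proof (rule sum_strict_mono_ex1)
        show "\<forall>k\<in>{..m}. (\<Sum>i<k. card (B i)) \<le> (\<Sum>i<k. card (A i))" using part by (metis le_add1)
        show "\<exists>k\<in>{..m}. (\<Sum>i<k. card (B i)) < (\<Sum>i<k. card (A i))"
          using part[of q] q by (intro bexI[of _ q]) auto
      qed auto
      show "finite (B i)" if "i < m" for i
        using less.prems(1) that p q unfolding B_def by auto
      show "(\<Sum>i<k. a i) \<le> (\<Sum>i<k. card (B i))" if "k \<le> m" for k
        using part[of k] strict[of k] less.prems(2)[OF that] by (auto split: if_splits)
      show "(\<Sum>i<m. a i) = (\<Sum>i<m. card (B i))"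
        using part[of m] less.prems(3) q by simp
    qed
    then show ?thesis using unit_transfer[OF p(1) q(2) x] unfolding B_def by simp
  qed
qed

section \<open>Every S-block comes from a split graph\<close>

text \<open>The split graph on \<open>{..<m + s}\<close> with clique \<open>{..<m}\<close> in which the clique vertex \<open>i\<close> is
  joined to the stable vertices \<open>m + x\<close> for \<open>x \<in> A i\<close>.  In this numbering the graphs
  constructed below have decreasing degrees.\<close>

definition split_edges :: "nat \<Rightarrow> (nat \<Rightarrow> nat set) \<Rightarrow> nat set set" where
  "split_edges m A = {{u, v} | u v. u < m \<and> v < m \<and> u \<noteq> v} \<union> {{i, m + x} | i x. i < m \<and> x \<in> A i}"

lemma split_edges_iff:
  "{u, v} \<in> split_edges m A \<longleftrightarrow>
    (u < m \<and> v < m \<and> u \<noteq> v) \<or> (u < m \<and> m \<le> v \<and> v - m \<in> A u) \<or> (v < m \<and> m \<le> u \<and> u - m \<in> A v)"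
  unfolding split_edges_def by (auto simp: doubleton_eq_iff)

lemma split_edges_graph:
  assumes "\<And>i. i < m \<Longrightarrow> A i \<noteq> {} \<and> A i \<subseteq> {..<s}" "\<And>x. x < s \<Longrightarrow> \<exists>i<m. x \<in> A i"
  shows "split_graph {..<m + s} (split_edges m A)"
proof -
  have G: "simple_graph {..<m + s} (split_edges m A)"
    unfolding simple_graph_def
  proof (intro conjI ballI)
    fix e assume "e \<in> split_edges m A"
    then show "e \<subseteq> {..<m + s}" "card e = 2"
      using assms(1) by (fastforce simp: split_edges_def card_insert_if)+
  next
    fix v assume v: "v \<in> {..<m + s}"
    have "\<exists>u. {v, u} \<in> split_edges m A"
    proof (cases "v < m")
      case True
      then obtain x where "x \<in> A v" using assms(1) by blast
      then show ?thesis using True by (intro exI[of _ "m + x"]) (simp add: split_edges_iff)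
    next
      case False
      then have "v - m < s" using v by auto
      then obtain i where "i < m" "v - m \<in> A i" using assms(2) by blast
      then show ?thesis using False by (intro exI[of _ i]) (simp add: split_edges_iff)
    qed
    then show "\<exists>e\<in>split_edges m A. v \<in> e" by blast
  qed simp
  have "KS_partition {..<m + s} (split_edges m A) {..<m} {m..<m + s}"
    unfolding KS_partition_def clique_def stable_set_def by (auto simp: split_edges_iff)
  then show ?thesis using G by (auto simp: split_graph_def)
qed

lemma degree_split_edges_clique:
  assumes "simple_graph V (split_edges m A)" "i < m" "finite (A i)"
  shows "degree (split_edges m A) i = m - 1 + card (A i)"
proof -
  have "{u. {u, i} \<in> split_edges m A} = ({..<m} - {i}) \<union> (+) m ` A i"
    using assms by (auto simp: split_edges_iff image_iff) (metis le_add_diff_inverse)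
  moreover have "card (({..<m} - {i}) \<union> (+) m ` A i) = card ({..<m} - {i}) + card ((+) m ` A i)"
    using assms by (intro card_Un_disjoint) auto
  ultimately show ?thesis
    unfolding degree_eq_card_neighbours[OF assms(1)] using assms by (simp add: card_image)
qed

lemma degree_split_edges_stable:
  assumes "simple_graph V (split_edges m A)" "m \<le> v"
  shows "degree (split_edges m A) v = card {i. i < m \<and> v - m \<in> A i}"
  unfolding degree_eq_card_neighbours[OF assms(1)]
  using assms(2) by (intro arg_cong[where f = card]) (auto simp: split_edges_iff)

lemma degree_sequence_lessThan:
  assumes "\<And>i j. i \<le> j \<Longrightarrow> j < N \<Longrightarrow> degree E j \<le> degree E i"
  shows "degree_sequence {..<N} E = map (degree E) [0..<N]"
proof -
  have "mset_set {..<N} = mset [0..<N]" by (simp add: mset_upt atLeast0LessThan)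
  then have "image_mset (degree E) (mset_set {..<N}) = mset (rev (map (degree E) [0..<N]))" by simp
  moreover have "sorted (rev (map (degree E) [0..<N]))"
    unfolding sorted_wrt_rev using assms by (auto simp: sorted_wrt_iff_nth_less)
  ultimately show ?thesis
    unfolding degree_sequence_def
    by (metis rev_rev_ident sorted_list_of_multiset_mset sorted_sort_id)
qed

text \<open>For antitone \<open>b\<close> the sets \<open>{..<b i}\<close> are nested, so \<open>x\<close> lies in at least \<open>j\<close> of them as
  soon as it lies in the \<open>j\<close>-th: the column sums of the staircase are the
  conjugate partition.\<close>

lemma card_antimono_level:
  fixes b :: "nat \<Rightarrow> nat"
  assumes "\<And>i j. i \<le> j \<Longrightarrow> j < m \<Longrightarrow> b j \<le> b i" "1 \<le> j" "j \<le> m"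
  shows "j \<le> card {i. i < m \<and> x < b i} \<longleftrightarrow> x < b (j - 1)"
proof
  assume h: "x < b (j - 1)"
  have "{..<j} \<subseteq> {i. i < m \<and> x < b i}"
    using h assms(1)[of _ "j - 1"] assms(2,3) by (fastforce intro: less_le_trans)
  then have "card {..<j} \<le> card {i. i < m \<and> x < b i}" by (intro card_mono) auto
  then show "j \<le> card {i. i < m \<and> x < b i}" by simp
next
  assume h: "j \<le> card {i. i < m \<and> x < b i}"
  show "x < b (j - 1)"
  proof (rule ccontr)
    assume n: "\<not> x < b (j - 1)"
    have "{i. i < m \<and> x < b i} \<subseteq> {..<j - 1}"
    proof
      fix i assume "i \<in> {i. i < m \<and> x < b i}"
      then show "i \<in> {..<j - 1}" using assms(1)[of "j - 1" i] n by force
    qed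
    then have "card {i. i < m \<and> x < b i} \<le> card {..<j - 1}" by (intro card_mono) auto
    then show False using h assms by simp
  qed
qed

lemma Dis_nth_less: "\<gamma> \<in> Dis n \<Longrightarrow> i < j \<Longrightarrow> j < length \<gamma> \<Longrightarrow> \<gamma> ! j < \<gamma> ! i"
  by (auto simp: Dis_def sorted_wrt_iff_nth_less)

text \<open>Parts are positive and drop by at least one from each index to the next.\<close>

lemma Dis_nth_ge:
  assumes "\<gamma> \<in> Dis n" "i < length \<gamma>"
  shows "length \<gamma> - i \<le> \<gamma> ! i"
proof -
  have "d < length \<gamma> \<Longrightarrow> Suc d \<le> \<gamma> ! (length \<gamma> - Suc d)" for d
  proof (induction d)
    case 0
    then show ?case using assms by (auto simp: Dis_def Suc_le_eq)
  next
    case (Suc d)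
    have "\<gamma> ! (length \<gamma> - Suc d) < \<gamma> ! (length \<gamma> - Suc (Suc d))"
      using Suc.prems by (intro Dis_nth_less[OF assms(1)]) auto
    then show ?case using Suc by simp
  qed
  from this[of "length \<gamma> - Suc i"] assms(2) show ?thesis by (simp add: Suc_diff_Suc)
qed

lemma sum_list_take: "k \<le> length xs \<Longrightarrow> sum_list (take k xs) = (\<Sum>i<k. xs ! i)"
  by (simp add: sum_list_sum_nth atLeast0LessThan min_def)

text \<open>With \<open>m = length \<alpha>\<close>, the graph has a clique of \<open>m\<close> vertices of degrees \<open>\<alpha> ! i + i\<close>
  (\<open>i < m\<close>), as required by the definition of \<open>alpha_part\<close>; so clique vertex \<open>i\<close> has
  \<open>a i = \<alpha> ! i + i - (m - 1)\<close> neighbours in the stable set.  Likewise \<open>beta_part\<close> requires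
  that \<open>b (j - 1) = \<beta> ! (j - 1) + j - m\<close> stable vertices have degree at least \<open>j\<close>.  Going from
  \<open>\<alpha>\<close> and \<open>\<beta>\<close> to \<open>a\<close> and \<open>b\<close> subtracts the same staircase, so \<open>b\<close> dominates \<open>a\<close> because
  \<open>\<beta>\<close> dominates \<open>\<alpha>\<close>; positivity and distinctness of the parts make \<open>a\<close> positive and both \<open>a\<close> and
  \<open>b\<close> antitone.\<close>

lemma S_block_realizable:
  assumes "n > 0" "(\<alpha>, \<beta>) \<in> S_Block n"
  shows "\<exists>(V :: nat set) E. split_graph V E \<and> V \<noteq> {} \<and>
    alpha_part (degree_sequence V E) = \<alpha> \<and> beta_part (degree_sequence V E) = \<beta>"
proof -
  have D: "\<alpha> \<in> Dis n" "\<beta> \<in> Dis n" and maj: "majorizes \<beta> \<alpha>"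
    and len: "length \<alpha> = length \<beta> \<or> length \<alpha> = length \<beta> + 1"
    using assms(2) by (auto simp: S_Block_def)
  define m where "m = length \<alpha>"
  \<comment> \<open>When \<open>\<beta>\<close> is one part shorter than \<open>\<alpha>\<close>, padding with a zero treats both cases alike.\<close>
  define \<beta>' where "\<beta>' i = (if i < length \<beta> then \<beta> ! i else 0)" for i
  define a where "a i = \<alpha> ! i - (m - Suc i)" for i
  define b where "b i = \<beta>' i - (m - Suc i)" for i
  have m: "m > 0" using assms(1) D(1) by (auto simp: m_def Dis_def)
  have \<alpha>ge: "m - i \<le> \<alpha> ! i" if "i < m" for i using Dis_nth_ge[OF D(1)] that by (simp add: m_def)
  have \<beta>ge: "m - Suc i \<le> \<beta>' i" if "i < m" for i
    using Dis_nth_ge[OF D(2), of i] that len by (auto simp: m_def \<beta>'_def)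
  have a: "a i + (m - Suc i) = \<alpha> ! i" "a i \<ge> 1" if "i < m" for i
    using \<alpha>ge[OF that] that by (auto simp: a_def)
  have b: "b i + (m - Suc i) = \<beta>' i" if "i < m" for i using \<beta>ge[OF that] by (simp add: b_def)
  have a_anti: "a j \<le> a i" if "i \<le> j" "j < m" for i j
    using that
  proof (induction rule: dec_induct)
    case (step k)
    have "\<alpha> ! Suc k < \<alpha> ! k" using step by (intro Dis_nth_less[OF D(1)]) (auto simp: m_def)
    then show ?case using step a(1)[of k] a(1)[of "Suc k"] by simp
  qed simp
  have b_anti: "b j \<le> b i" if "i \<le> j" "j < m" for i j
    using that
  proof (induction rule: dec_induct)
    case (step k)
    have "\<beta>' (Suc k) < \<beta>' k \<or> \<beta>' (Suc k) = 0"
      using Dis_nth_less[OF D(2), of k "Suc k"] by (auto simp: \<beta>'_def)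
    then show ?case using step b[of k] b[of "Suc k"] by auto
  qed simp
  have \<alpha>sum: "(\<Sum>i<m. \<alpha> ! i) = n"
    using sum_list_take[of m \<alpha>] D(1) by (simp add: m_def Dis_def)
  have \<beta>sum: "(\<Sum>i<m. \<beta>' i) = n"
  proof -
    have "(\<Sum>i<m. \<beta>' i) = (\<Sum>i<length \<beta>. \<beta>' i)"
      using len by (intro sum.mono_neutral_right) (auto simp: m_def \<beta>'_def)
    also have "\<dots> = (\<Sum>i<length \<beta>. \<beta> ! i)" by (intro sum.cong) (auto simp: \<beta>'_def)
    also have "\<dots> = n" using sum_list_take[of "length \<beta>" \<beta>] D(2) by (simp add: Dis_def)
    finally show ?thesis .
  qed
  \<comment> \<open>The definition of majorization is silent about \<open>k = m\<close> when \<open>\<beta>\<close> is shorter; there both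
    sums are \<open>n\<close>.\<close>
  have dom': "(\<Sum>i<k. \<alpha> ! i) \<le> (\<Sum>i<k. \<beta>' i)" if k: "k \<le> m" for k
  proof (cases "k \<le> length \<beta>")
    case True
    have "(\<Sum>i<k. \<alpha> ! i) = sum_list (take k \<alpha>)" using k by (simp add: sum_list_take m_def)
    also have "\<dots> \<le> sum_list (take k \<beta>)" using maj True k by (simp add: majorizes_def m_def)
    also have "\<dots> = (\<Sum>i<k. \<beta> ! i)" using True by (simp add: sum_list_take)
    also have "\<dots> = (\<Sum>i<k. \<beta>' i)" using True by (intro sum.cong) (auto simp: \<beta>'_def)
    finally show ?thesis .
  next
    case False
    then have "k = m" using k len by (auto simp: m_def)
    then show ?thesis using \<alpha>sum \<beta>sum by simp
  qed
  have asum: "(\<Sum>i<k. a i) + (\<Sum>i<k. m - Suc i) = (\<Sum>i<k. \<alpha> ! i)" if "k \<le> m" for k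
    unfolding sum.distrib[symmetric] using a(1) that by (intro sum.cong) auto
  have bsum: "(\<Sum>i<k. b i) + (\<Sum>i<k. m - Suc i) = (\<Sum>i<k. \<beta>' i)" if "k \<le> m" for k
    unfolding sum.distrib[symmetric] using b that by (intro sum.cong) auto
  have "\<exists>A. (\<forall>i<m. finite (A i) \<and> card (A i) = a i) \<and>
    (\<forall>x. card {i. i < m \<and> x \<in> A i} = card {i. i < m \<and> x \<in> {..<b i}})"
  proof (rule exists_sets_of_sizes)
    show "(\<Sum>i<k. a i) \<le> (\<Sum>i<k. card {..<b i})" if "k \<le> m" for k
      using asum[OF that] bsum[OF that] dom'[OF that] by simp
    show "(\<Sum>i<m. a i) = (\<Sum>i<m. card {..<b i})"
      using asum[of m] bsum[of m] \<alpha>sum \<beta>sum by simp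
  qed (use a_anti in auto)
  then obtain A where A: "\<And>i. i < m \<Longrightarrow> finite (A i)" "\<And>i. i < m \<Longrightarrow> card (A i) = a i"
    and col: "\<And>x. card {i. i < m \<and> x \<in> A i} = card {i. i < m \<and> x < b i}" by auto
  define s where "s = b 0"
  define E where "E = split_edges m A"
  have level: "j \<le> card {i. i < m \<and> x \<in> A i} \<longleftrightarrow> x < b (j - 1)" if "1 \<le> j" "j \<le> m" for j x
    unfolding col using b_anti that by (intro card_antimono_level) auto
  have occ: "(\<exists>i<m. x \<in> A i) \<longleftrightarrow> x < s" for x
  proof -
    have "(\<exists>i<m. x \<in> A i) \<longleftrightarrow> 1 \<le> card {i. i < m \<and> x \<in> A i}"
      by (auto simp: Suc_le_eq card_gt_0_iff)
    then show ?thesis using level[of 1 x] m by (simp add: s_def)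
  qed
  have splitG: "split_graph {..<m + s} E"
    unfolding E_def
  proof (rule split_edges_graph)
    fix i assume i: "i < m"
    have "A i \<noteq> {}" using A(2)[OF i] a(2)[OF i] by auto
    then show "A i \<noteq> {} \<and> A i \<subseteq> {..<s}" using occ i by blast
  qed (use occ in blast)
  then have G: "simple_graph {..<m + s} E" by (simp add: split_graph_def)
  have degK: "degree E i = \<alpha> ! i + i" if "i < m" for i
    using degree_split_edges_clique[OF G[unfolded E_def] that A(1)[OF that]] A(2)[OF that]
      a(1)[OF that] that unfolding E_def by simp
  have degKm: "m \<le> degree E i" if "i < m" for i using degK[OF that] \<alpha>ge[OF that] by simp
  have degS: "degree E v = card {i. i < m \<and> v - m < b i}" if "m \<le> v" for v
    using degree_split_edges_stable[OF G[unfolded E_def] that] unfolding E_def col .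
  have degSm: "degree E v \<le> m" if "m \<le> v" for v
    unfolding degS[OF that] using card_mono[of "{..<m}" "{i. i < m \<and> v - m < b i}"] by auto
  have "degree E j \<le> degree E i" if "i \<le> j" "j < m + s" for i j
  proof -
    consider "j < m" | "i < m" "m \<le> j" | "m \<le> i" by linarith
    then show ?thesis
    proof cases
      case 1
      then have "degree E i = m - 1 + a i" "degree E j = m - 1 + a j"
        using degK a(1) that by (auto simp: degK a(1)[symmetric])
      then show ?thesis using a_anti[OF that(1) 1] by simp
    next
      case 2
      then show ?thesis using degKm[of i] degSm[of j] by simp
    next
      case 3
      then show ?thesis unfolding degS[OF 3] degS[OF order_trans[OF 3 that(1)]]
        using that(1) by (intro card_mono) auto
    qed
  qed
  then have seq: "degree_sequence {..<m + s} E = map (degree E) [0..<m + s]"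
    by (rule degree_sequence_lessThan)
  let ?p = "degree_sequence {..<m + s} E"
  have len_p: "length ?p = m + s" unfolding seq by simp
  have nth_p: "?p ! i = degree E i" if "i < m + s" for i unfolding seq using that by simp
  have "filter (\<lambda>i. ?p ! (i - 1) \<ge> i) [1..<length ?p + 1] = [1..<m + 1]"
  proof (rule filter_upt_initial)
    fix i assume i: "1 \<le> i" "i \<le> length ?p"
    show "i \<le> ?p ! (i - 1) \<longleftrightarrow> i \<le> m"
    proof (cases "i \<le> m")
      case True
      then have "i - 1 < m" using i by simp
      from degKm[OF this] show ?thesis using True i len_p by (simp add: nth_p)
    next
      case False
      then have "m \<le> i - 1" by simp
      from degSm[OF this] show ?thesis using False i len_p by (simp add: nth_p)
    qed
  qed (simp add: len_p)
  then have "alpha_part ?p = map (\<lambda>i. ?p ! (i - 1) + 1 - i) [1..<m + 1]"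
    unfolding alpha_part_eq by simp
  also have "\<dots> = \<alpha>"
    by (rule nth_equalityI) (auto simp: m_def[symmetric] nth_p degK simp del: upt_Suc)
  finally have alpha: "alpha_part ?p = \<alpha>" .
  \<comment> \<open>For \<open>j \<le> m\<close>, all of the clique and the first \<open>b (j - 1)\<close> stable vertices have degree at least
    \<open>j\<close>; beyond \<open>m\<close> only clique vertices remain, so no column reaches below the diagonal.\<close>
  have conj_low: "conj_part ?p j = \<beta>' (j - 1) + j" if j: "1 \<le> j" "j \<le> m" for j
  proof -
    have "{v \<in> {..<m + s}. j \<le> degree E v} = {..<m + b (j - 1)}" (is "?L = ?R")
    proof (rule set_eqI)
      fix v
      have "b (j - 1) \<le> s" using b_anti[of 0 "j - 1"] j by (simp add: s_def)
      moreover have "j \<le> degree E v \<longleftrightarrow> v < m + b (j - 1)" if "m \<le> v"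
        using level[OF j, of "v - m"] that j unfolding degS[OF that] col by auto
      moreover have "j \<le> degree E v" if "v < m" using degKm[OF that] j by simp
      ultimately show "v \<in> ?L \<longleftrightarrow> v \<in> ?R" by (cases "v < m") auto
    qed
    then have "conj_part ?p j = m + b (j - 1)"
      by (simp add: conj_part_degree_sequence degree_count_def)
    moreover have "j - 1 < m" using j by simp
    ultimately show ?thesis using b[of "j - 1"] j by simp
  qed
  have conj_high: "conj_part ?p j \<le> m" if "m < j" for j
  proof -
    have "{v \<in> {..<m + s}. j \<le> degree E v} \<subseteq> {..<m}"
    proof
      fix v assume "v \<in> {v \<in> {..<m + s}. j \<le> degree E v}"
      then show "v \<in> {..<m}" using degSm[of v] that by (cases "v < m") auto
    qed
    then have "card {v \<in> {..<m + s}. j \<le> degree E v} \<le> card {..<m}" by (intro card_mono) auto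
    then show ?thesis by (simp add: conj_part_degree_sequence degree_count_def)
  qed
  have "filter (\<lambda>j. conj_part ?p j > j) [1..<length ?p + 1] = [1..<length \<beta> + 1]"
  proof (rule filter_upt_initial)
    fix j assume j: "1 \<le> j" "j \<le> length ?p"
    have pos: "\<beta>' (j - 1) > 0 \<longleftrightarrow> j \<le> length \<beta>"
      using D(2) j by (auto simp: \<beta>'_def Dis_def)
    show "j < conj_part ?p j \<longleftrightarrow> j \<le> length \<beta>"
    proof (cases "j \<le> m")
      case True
      then show ?thesis using conj_low[OF j(1) True] pos by simp
    next
      case False
      then show ?thesis using conj_high[of j] len by (auto simp: m_def)
    qed
  next
    have "length \<beta> \<le> m" using len by (auto simp: m_def)
    then show "length \<beta> \<le> length ?p" unfolding len_p by simp
  qed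
  then have "beta_part ?p = map (\<lambda>j. conj_part ?p j - j) [1..<length \<beta> + 1]"
    unfolding beta_part_eq by simp
  also have "\<dots> = \<beta>"
  proof (rule nth_equalityI)
    fix i assume "i < length (map (\<lambda>j. conj_part ?p j - j) [1..<length \<beta> + 1])"
    then have i: "i < length \<beta>" by (simp del: upt_Suc)
    then have "conj_part ?p (Suc i) = \<beta> ! i + Suc i"
      using conj_low[of "Suc i"] len by (auto simp: m_def \<beta>'_def)
    then show "map (\<lambda>j. conj_part ?p j - j) [1..<length \<beta> + 1] ! i = \<beta> ! i"
      using i by (simp del: upt_Suc)
  qed (simp del: upt_Suc)
  finally have beta: "beta_part ?p = \<beta>" .
  show ?thesis using splitG alpha beta m by (intro exI[of _ "{..<m + s}"] exI[of _ E]) auto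
qed

section \<open>Balance along the order on S-blocks\<close>

lemma Dis_nonempty: "n > 0 \<Longrightarrow> \<gamma> \<in> Dis n \<Longrightarrow> \<gamma> \<noteq> []"
  by (auto simp: Dis_def)

lemma block_vertices_nonempty: "alpha_part (degree_sequence V E) \<noteq> [] \<Longrightarrow> V \<noteq> {}"
  by (auto simp: degree_sequence_def alpha_part_def)

lemma balanced_block_iff:
  assumes "n > 0" "(\<alpha>, \<beta>) \<in> S_Block n"
  shows "balanced_block (\<alpha>, \<beta>) \<longleftrightarrow> length \<alpha> \<noteq> length \<beta>"
proof
  assume "balanced_block (\<alpha>, \<beta>)"
  then obtain V :: "nat set" and E where VE: "balanced_split_graph V E"
    "\<alpha> = alpha_part (degree_sequence V E)" "\<beta> = beta_part (degree_sequence V E)"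
    by (auto simp: balanced_block_def)
  moreover have "V \<noteq> {}" using Dis_nonempty[OF assms(1), of \<alpha>] assms(2) VE
    by (intro block_vertices_nonempty) (auto simp: S_Block_def)
  ultimately show "length \<alpha> \<noteq> length \<beta>"
    using balanced_iff_length[of V E] by (auto simp: balanced_split_graph_def)
next
  assume "length \<alpha> \<noteq> length \<beta>"
  then show "balanced_block (\<alpha>, \<beta>)"
    using S_block_realizable[OF assms] balanced_iff_length unfolding balanced_block_def by blast
qed

lemma unbalanced_block_iff:
  assumes "n > 0" "(\<alpha>, \<beta>) \<in> S_Block n"
  shows "unbalanced_block (\<alpha>, \<beta>) \<longleftrightarrow> length \<alpha> = length \<beta>"
proof
  assume "unbalanced_block (\<alpha>, \<beta>)"
  then obtain V :: "nat set" and E where VE: "unbalanced_split_graph V E"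
    "\<alpha> = alpha_part (degree_sequence V E)" "\<beta> = beta_part (degree_sequence V E)"
    by (auto simp: unbalanced_block_def)
  moreover have "V \<noteq> {}" using Dis_nonempty[OF assms(1), of \<alpha>] assms(2) VE
    by (intro block_vertices_nonempty) (auto simp: S_Block_def)
  ultimately show "length \<alpha> = length \<beta>"
    using balanced_iff_length[of V E] by (auto simp: unbalanced_split_graph_def)
next
  assume "length \<alpha> = length \<beta>"
  then show "unbalanced_block (\<alpha>, \<beta>)"
    using S_block_realizable[OF assms] balanced_iff_length
    unfolding unbalanced_block_def unbalanced_split_graph_def by blast
qed

lemma majorizes_length_le:
  assumes "majorizes \<delta> \<gamma>" "\<delta> \<in> Dis n" "\<gamma> \<in> Dis n"
  shows "length \<delta> \<le> length \<gamma>"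
proof (rule ccontr)
  assume n: "\<not> length \<delta> \<le> length \<gamma>"
  let ?k = "length \<gamma>"
  have "sum_list (take ?k \<gamma>) \<le> sum_list (take ?k \<delta>)"
    using assms(1)[unfolded majorizes_def, rule_format, of ?k] n by simp
  then have "n \<le> sum_list (take ?k \<delta>)" using assms(3) by (simp add: Dis_def)
  moreover have "n = sum_list (take ?k \<delta>) + sum_list (drop ?k \<delta>)"
    using assms(2) by (simp add: Dis_def flip: sum_list_append)
  ultimately have "sum_list (drop ?k \<delta>) = 0" by simp
  moreover have "\<delta> ! ?k \<in> set (drop ?k \<delta>)" using n by (auto simp: Cons_nth_drop_Suc[symmetric])
  ultimately have "\<delta> ! ?k = 0" by (auto simp: sum_list_eq_0_iff)
  moreover have "\<delta> ! ?k \<in> set \<delta>" using n by (intro nth_mem) simp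
  ultimately show False using assms(2) by (auto simp: Dis_def)
qed

theorem theorem3p18:
  fixes n :: nat and \<alpha>1 \<beta>1 \<alpha>2 \<beta>2 :: "nat list"
  assumes "n > 0"
    and "(\<alpha>1, \<beta>1) \<in> S_Block n"
    and "(\<alpha>2, \<beta>2) \<in> S_Block n"
    and "block_ge (\<alpha>1, \<beta>1) (\<alpha>2, \<beta>2)"
  shows "(balanced_block (\<alpha>1, \<beta>1) \<longrightarrow> balanced_block (\<alpha>2, \<beta>2)) \<and>
         (unbalanced_block (\<alpha>2, \<beta>2) \<longrightarrow> unbalanced_block (\<alpha>1, \<beta>1))"
proof -
  have D: "\<alpha>1 \<in> Dis n" "\<alpha>2 \<in> Dis n" "\<beta>1 \<in> Dis n" "\<beta>2 \<in> Dis n"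
    and len: "length \<beta>1 \<le> length \<alpha>1" "length \<beta>2 \<le> length \<alpha>2"
    using assms(2,3) by (auto simp: S_Block_def)
  have "length \<alpha>1 \<le> length \<alpha>2" "length \<beta>2 \<le> length \<beta>1"
    using assms(4) D majorizes_length_le by (auto simp: block_ge_def)
  then show ?thesis
    using len balanced_block_iff[OF assms(1,2)] balanced_block_iff[OF assms(1,3)]
      unbalanced_block_iff[OF assms(1,2)] unbalanced_block_iff[OF assms(1,3)]
    by auto
qed

end
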